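(* Let $S\subseteq\mathbb{N}^d$ be a $\mathcal{C}$-semigroup, let $\prec$ be a term order on $\mathbb{N}^d$, and let $F(S)_\prec$ denote the Frobenius element of $S$ with respect to $\prec$. Then $S$ is a $\prec$-pseudo-symmetric semigroup if and only if $F(S)_\prec$ is even and for each $g\in\mathrm{cone}(S)\cap\mathbb{N}^d$ we have $$g\in S\iff \bigl(F(S)_\prec-g\notin S\ \text{ and }\ g\neq F(S)_\prec/2\bigr).$$
   Context: $\mathbb{N}$ denotes the non-negative integers. An affine semigroup $S$ is a finitely generated submonoid of $\mathbb{N}^d$, with minimal generating set $\{a_1,\dots,a_n\}$. Put $\mathrm{cone}(S)=\{\sum_{i=1}^n\lambda_i a_i\mid \lambda_i\in\mathbb{Q}_{\ge 0}\}$ and $\mathcal{H}(S)=(\mathrm{cone}(S)\setminus S)\cap\mathbb{N}^d$. The set of pseudo-Frobenius elements is $\mathrm{PF}(S)=\{f\in\mathcal{H}(S)\mid f+s\in S \text{ for all } s\in S\setminus\{0\}\}$. $S$ is an MPD-semigroup if $\mathrm{PF}(S)\neq\emptyset$. $S$ is a $\mathcal{C}$-semigroup if it is an MPD-semigroup and $\mathcal{H}(S)$ is non-empty and finite. A term order (monomial ordering) on $\mathbb{N}^d$ is a total order $\prec$ compatible with addition and with $0\prec a$ for all $a\neq 0$. The Frobenius element with respect to $\prec$ is $F(S)_\prec=\max_\prec\mathcal{H}(S)$ (if it exists; it does when $\mathcal{H}(S)$ is finite and non-empty). "$F(S)_\prec$ is even" means all its coordinates are even. Put $\mathrm{PF}'_\prec(S)=\mathrm{PF}(S)\setminus\{F(S)_\prec\}$.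 $S$ is $\prec$-almost symmetric if $F(S)_\prec$ exists, $\mathrm{PF}'_\prec(S)\neq\emptyset$, and $F(S)_\prec-g\in\mathrm{PF}'_\prec(S)$ for every $g\in\mathrm{PF}'_\prec(S)$. $S$ is $\prec$-pseudo-symmetric if it is $\prec$-almost symmetric and $|\mathrm{PF}(S)|=2$; in this case $\mathrm{PF}(S)=\{F(S)_\prec,F(S)_\prec/2\}$. *)

theory Defs
  imports "HOL-Analysis.Finite_Cartesian_Product" "HOL.Hull"
begin

text \<open>
  The ambient space is \<open>\<rat>\<^sup>d\<close>, written \<open>rat^'d\<close>, with \<open>\<nat>\<^sup>d\<close> embedded as the set of vectors with natural
  entries. Thus \<open>F - g\<close> and \<open>F/2\<close> are the true difference and the true half, with no
  truncation or rounding, and \<open>F - g \<notin> S\<close> includes the case where \<open>F - g\<close> has a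
  negative entry.
\<close>

definition nat_vecs :: "(rat^'d::finite) set" where
  "nat_vecs = {x. \<forall>i. x $ i \<in> \<nat>}"

definition add_submonoid :: "'a::comm_monoid_add set \<Rightarrow> bool" where
  "add_submonoid M \<longleftrightarrow> 0 \<in> M \<and> (\<forall>x\<in>M. \<forall>y\<in>M. x + y \<in> M)"

definition affine_semigroup :: "(rat^'d::finite) set \<Rightarrow> bool" where
  "affine_semigroup S \<longleftrightarrow> S \<subseteq> nat_vecs \<and> (\<exists>A. finite A \<and> add_submonoid hull A = S)"

definition minimal_generating_set :: "(rat^'d::finite) set \<Rightarrow> (rat^'d) set \<Rightarrow> bool" where
  "minimal_generating_set A S \<longleftrightarrow>
     finite A \<and> add_submonoid hull A = S \<and> (\<forall>B. B \<subset> A \<longrightarrow> add_submonoid hull B \<noteq> S)"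

text \<open>
  An affine semigroup has exactly one minimal generating set, so the existential
  quantifier over \<open>A\<close> only names it.
\<close>

definition rational_cone :: "(rat^'d::finite) set \<Rightarrow> (rat^'d) set" where
  "rational_cone S =
     {x. \<exists>A c. minimal_generating_set A S \<and> (\<forall>a\<in>A. 0 \<le> c a) \<and> x = (\<Sum>a\<in>A. c a *s a)}"

definition gaps :: "(rat^'d::finite) set \<Rightarrow> (rat^'d) set" where
  "gaps S = (rational_cone S - S) \<inter> nat_vecs"

definition pseudo_Frobenius :: "(rat^'d::finite) set \<Rightarrow> (rat^'d) set" where
  "pseudo_Frobenius S = {f \<in> gaps S. \<forall>s \<in> S - {0}. f + s \<in> S}"

definition MPD_semigroup :: "(rat^'d::finite) set \<Rightarrow> bool" where
  "MPD_semigroup S \<longleftrightarrow> affine_semigroup S \<and> pseudo_Frobenius S \<noteq> {}"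

definition C_semigroup :: "(rat^'d::finite) set \<Rightarrow> bool" where
  "C_semigroup S \<longleftrightarrow> MPD_semigroup S \<and> gaps S \<noteq> {} \<and> finite (gaps S)"

text \<open>Term orders are given by their strict part; only its restriction to \<open>\<nat>\<^sup>d\<close> matters.\<close>

definition term_order :: "(rat^'d::finite \<Rightarrow> rat^'d \<Rightarrow> bool) \<Rightarrow> bool" where
  "term_order prec \<longleftrightarrow>
     irreflp_on nat_vecs prec \<and> transp_on nat_vecs prec \<and> totalp_on nat_vecs prec \<and>
     (\<forall>a\<in>nat_vecs. \<forall>b\<in>nat_vecs. \<forall>c\<in>nat_vecs. prec a b \<longrightarrow> prec (a + c) (b + c)) \<and>
     (\<forall>a\<in>nat_vecs. a \<noteq> 0 \<longrightarrow> prec 0 a)"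

definition is_Frobenius ::
  "(rat^'d::finite \<Rightarrow> rat^'d \<Rightarrow> bool) \<Rightarrow> (rat^'d) set \<Rightarrow> rat^'d \<Rightarrow> bool" where
  "is_Frobenius prec S F \<longleftrightarrow> F \<in> gaps S \<and> (\<forall>h \<in> gaps S. h \<noteq> F \<longrightarrow> prec h F)"

text \<open>Meaningful when \<open>gaps S\<close> has a greatest element, which is then unique for a term order.\<close>

definition Frobenius :: "(rat^'d::finite \<Rightarrow> rat^'d \<Rightarrow> bool) \<Rightarrow> (rat^'d) set \<Rightarrow> rat^'d" where
  "Frobenius prec S = (THE F. is_Frobenius prec S F)"

definition even_vec :: "rat^'d::finite \<Rightarrow> bool" where
  "even_vec x \<longleftrightarrow> (\<forall>i. \<exists>k::int. x $ i = 2 * of_int k)"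

definition pseudo_Frobenius' ::
  "(rat^'d::finite \<Rightarrow> rat^'d \<Rightarrow> bool) \<Rightarrow> (rat^'d) set \<Rightarrow> (rat^'d) set" where
  "pseudo_Frobenius' prec S = pseudo_Frobenius S - {Frobenius prec S}"

definition almost_symmetric ::
  "(rat^'d::finite \<Rightarrow> rat^'d \<Rightarrow> bool) \<Rightarrow> (rat^'d) set \<Rightarrow> bool" where
  "almost_symmetric prec S \<longleftrightarrow>
     (\<exists>F. is_Frobenius prec S F) \<and> pseudo_Frobenius' prec S \<noteq> {} \<and>
     (\<forall>g \<in> pseudo_Frobenius' prec S. Frobenius prec S - g \<in> pseudo_Frobenius' prec S)"

definition pseudo_symmetric ::
  "(rat^'d::finite \<Rightarrow> rat^'d \<Rightarrow> bool) \<Rightarrow> (rat^'d) set \<Rightarrow> bool" where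
  "pseudo_symmetric prec S \<longleftrightarrow> almost_symmetric prec S \<and> card (pseudo_Frobenius S) = 2"

end

theory Submission
  imports Defs
begin

text \<open>
  Adding a suitable element of \<open>S\<close> to a gap turns it into a pseudo-Frobenius element: among the
  finitely many gaps \<open>g + s\<close> with \<open>s \<in> S\<close>, the greatest one is pseudo-Frobenius. If
  \<open>PF(S) = {F, F/2}\<close>, a gap \<open>g\<close> therefore satisfies \<open>g + s = F\<close> or \<open>g + s = F/2\<close>; in the second
  case \<open>F - g = F/2 + s\<close>, which lies in \<open>S\<close> unless \<open>s = 0\<close>. Conversely, the symmetry condition
  forces \<open>F/2\<close> to be pseudo-Frobenius, and any \<open>f \<noteq> F/2\<close> in \<open>PF(S)\<close> has \<open>F - f \<in> S\<close>, whence
  \<open>f = F\<close> because \<open>F \<notin> S\<close>.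
\<close>

subsection \<open>The rational cone\<close>

lemma add_submonoid_hull: "add_submonoid (add_submonoid hull A)"
  by (rule hull_in) (simp add: add_submonoid_def)

lemma add_submonoid_zero: "add_submonoid M \<Longrightarrow> 0 \<in> M"
  and add_submonoid_add: "add_submonoid M \<Longrightarrow> x \<in> M \<Longrightarrow> y \<in> M \<Longrightarrow> x + y \<in> M"
  by (simp_all add: add_submonoid_def)

lemma add_submonoid_sum:
  assumes "add_submonoid M" "\<And>a. a \<in> A \<Longrightarrow> f a \<in> M"
  shows "sum f A \<in> M"
  using assms(2)
  by (induction A rule: infinite_finite_induct)
    (simp_all add: add_submonoid_zero add_submonoid_add assms(1))

lemma add_submonoid_of_nat_scale:
  fixes M :: "('a::semiring_1^'d) set"
  assumes "add_submonoid M" "x \<in> M"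
  shows "of_nat n *s x \<in> M"
  by (induction n)
    (simp_all add: vector_sadd_rdistrib add_submonoid_zero add_submonoid_add assms)

lemma add_submonoid_nat_vecs: "add_submonoid nat_vecs"
  by (simp add: add_submonoid_def nat_vecs_def)

text \<open>Induction on \<open>A\<close>: the multiplier obtained so far is multiplied by the
  denominator of the new coefficient. Nonnegativity turns the integer numerator into a natural
  number.\<close>

lemma common_denominator:
  fixes c :: "'a \<Rightarrow> rat"
  assumes "finite A" "\<And>a. a \<in> A \<Longrightarrow> 0 \<le> c a"
  shows "\<exists>k>0. \<forall>a\<in>A. of_nat k * c a \<in> \<nat>"
  using assms
proof (induction A)
  case empty
  then show ?case by (auto intro: exI[of _ "1::nat"])
next
  case (insert b A)
  then obtain k where k: "k > 0" "\<And>a. a \<in> A \<Longrightarrow> of_nat k * c a \<in> \<nat>"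
    by auto
  obtain p q where pq: "quotient_of (c b) = (p, q)"
    by fastforce
  have q: "q > 0" and cb: "c b = of_int p / of_int q"
    using quotient_of_denom_pos[OF pq] quotient_of_div[OF pq] by auto
  have p: "p \<ge> 0"
    using insert.prems[of b] q unfolding cb by (simp add: zero_le_divide_iff)
  have "of_nat (nat q) * c b = of_nat (nat p)"
    using p q by (simp add: cb)
  then have *: "of_nat (nat q * k) * c b = of_nat (nat p * k)"
    by (metis mult.assoc mult.commute of_nat_mult)
  have "of_nat (nat q * k) * c a \<in> \<nat>" if "a \<in> A" for a
    using Nats_mult[OF of_nat_in_Nats[of "nat q"] k(2)[OF that]] by (simp add: mult.assoc)
  moreover have "of_nat (nat q * k) * c b \<in> \<nat>"
    unfolding * by (rule of_nat_in_Nats)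
  moreover have "nat q * k > 0"
    using q k(1) by simp
  ultimately show ?case by blast
qed

text \<open>The nonnegative combinations of \<open>A\<close> form a submonoid containing
  \<open>A\<close>, hence contain its hull.\<close>

lemma hull_imp_nonneg_combination:
  fixes A :: "('a::linordered_semidom^'d) set"
  assumes "finite A" "x \<in> add_submonoid hull A"
  obtains c where "\<And>a. a \<in> A \<Longrightarrow> 0 \<le> c a" "x = (\<Sum>a\<in>A. c a *s a)"
proof -
  let ?K = "{x. \<exists>c. (\<forall>a\<in>A. 0 \<le> c a) \<and> x = (\<Sum>a\<in>A. c a *s a)}"
  have "add_submonoid ?K"
    unfolding add_submonoid_def
  proof (intro conjI ballI)
    show "0 \<in> ?K" by (auto intro!: exI[of _ "\<lambda>_. 0"])
    fix x y assume "x \<in> ?K" "y \<in> ?K"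
    then obtain c d where "\<forall>a\<in>A. 0 \<le> c a" "x = (\<Sum>a\<in>A. c a *s a)"
      "\<forall>a\<in>A. 0 \<le> d a" "y = (\<Sum>a\<in>A. d a *s a)" by blast
    then show "x + y \<in> ?K"
      by (auto intro!: exI[of _ "\<lambda>a. c a + d a"] simp: vector_sadd_rdistrib sum.distrib)
  qed
  moreover have "A \<subseteq> ?K"
  proof
    fix b assume "b \<in> A"
    have "(\<Sum>a\<in>A. (if a = b then 1 else 0) *s a) = (\<Sum>a\<in>A. if a = b then a else 0)"
      by (rule sum.cong) auto
    also have "\<dots> = b" using \<open>b \<in> A\<close> assms(1) by simp
    finally show "b \<in> ?K"
      by (auto intro!: exI[of _ "\<lambda>a. if a = b then 1 else 0"])
  qed
  ultimately have "add_submonoid hull A \<subseteq> ?K"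
    by (rule hull_minimal[rotated])
  with assms(2) that show thesis by blast
qed

text \<open>Clearing denominators moves a cone element into \<open>S\<close>; dividing by
  \<open>k\<close> leads back. The resulting description of the cone is free of generators, so
  closure under sums and halves only needs a suitable multiplier.\<close>

lemma mem_rational_cone_iff:
  assumes "minimal_generating_set A S"
  shows "x \<in> rational_cone S \<longleftrightarrow> (\<exists>k>0. of_nat k *s x \<in> S)"
proof
  assume "x \<in> rational_cone S"
  then obtain B c where B: "minimal_generating_set B S" and c: "\<And>b. b \<in> B \<Longrightarrow> 0 \<le> c b"
    and x: "x = (\<Sum>b\<in>B. c b *s b)"
    unfolding rational_cone_def by blast
  have "finite B" and S: "S = add_submonoid hull B"
    using B by (auto simp: minimal_generating_set_def)
  obtain k where k: "k > 0" "\<And>b. b \<in> B \<Longrightarrow> of_nat k * c b \<in> \<nat>"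
    using common_denominator[OF \<open>finite B\<close>, of c] c by auto
  have sub: "add_submonoid S" unfolding S by (rule add_submonoid_hull)
  have "(of_nat k * c b) *s b \<in> S" if b: "b \<in> B" for b
  proof -
    obtain n where "of_nat k * c b = of_nat n"
      using k(2)[OF b] by (rule Nats_cases)
    moreover have "b \<in> S" unfolding S by (rule hull_inc[OF b])
    ultimately show ?thesis by (simp only: add_submonoid_of_nat_scale[OF sub])
  qed
  then have "(\<Sum>b\<in>B. (of_nat k * c b) *s b) \<in> S"
    by (rule add_submonoid_sum[OF sub])
  moreover have "(\<Sum>b\<in>B. (of_nat k * c b) *s b) = of_nat k *s x"
    by (simp add: x vec_eq_iff sum_distrib_left mult.assoc)
  ultimately have "of_nat k *s x \<in> S"
    by simp
  with k(1) show "\<exists>k>0. of_nat k *s x \<in> S" by blast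
next
  assume "\<exists>k>0. of_nat k *s x \<in> S"
  then obtain k where k: "k > 0" "of_nat k *s x \<in> S" by blast
  have "finite A" and S: "S = add_submonoid hull A"
    using assms by (auto simp: minimal_generating_set_def)
  obtain c where c: "\<And>a. a \<in> A \<Longrightarrow> 0 \<le> c a" and kx: "of_nat k *s x = (\<Sum>a\<in>A. c a *s a)"
    using hull_imp_nonneg_combination[OF \<open>finite A\<close> k(2)[unfolded S]] by metis
  have "x = (1 / of_nat k) *s (of_nat k *s x)"
    using k(1) by (simp add: vector_smult_assoc)
  then have "x = (\<Sum>a\<in>A. (c a / of_nat k) *s a)"
    by (simp add: kx vec_eq_iff sum_distrib_left sum_divide_distrib)
  moreover have "\<forall>a\<in>A. 0 \<le> c a / of_nat k"
    using c by simp
  ultimately show "x \<in> rational_cone S"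
    unfolding rational_cone_def mem_Collect_eq using assms
    by (intro exI[of _ A] exI[of _ "\<lambda>a. c a / of_nat k"] conjI)
qed

subsection \<open>Gaps of a C-semigroup\<close>

locale C_semigroup_order =
  fixes S :: "(rat^'d::finite) set" and prec :: "rat^'d \<Rightarrow> rat^'d \<Rightarrow> bool"
  assumes C_semigroup: "C_semigroup S" and term_order: "term_order prec"
begin

lemma S_subset_nat_vecs: "S \<subseteq> nat_vecs"
  and add_submonoid_S: "add_submonoid S"
  and finite_gaps: "finite (gaps S)"
  and gaps_nonempty: "gaps S \<noteq> {}"
  using C_semigroup add_submonoid_hull
  by (auto simp: C_semigroup_def MPD_semigroup_def affine_semigroup_def)

lemma zero_in_S: "0 \<in> S" and S_add: "x \<in> S \<Longrightarrow> y \<in> S \<Longrightarrow> x + y \<in> S"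
  using add_submonoid_S by (simp_all add: add_submonoid_zero add_submonoid_add)

lemma cone_iff: "x \<in> rational_cone S \<longleftrightarrow> (\<exists>k>0. of_nat k *s x \<in> S)"
proof -
  \<comment> \<open>Any element of the cone comes with a minimal generating set, so the existence of
    a gap supplies one.\<close>
  obtain A where "minimal_generating_set A S"
    using gaps_nonempty by (auto simp: gaps_def rational_cone_def)
  then show ?thesis by (rule mem_rational_cone_iff)
qed

lemma S_subset_cone: "S \<subseteq> rational_cone S"
  by (auto simp: cone_iff intro!: exI[of _ "1::nat"])

lemma cone_add:
  assumes "x \<in> rational_cone S" "y \<in> rational_cone S"
  shows "x + y \<in> rational_cone S"
proof -
  obtain k l where "k > 0" "of_nat k *s x \<in> S" "l > 0" "of_nat l *s y \<in> S"
    using assms by (auto simp: cone_iff)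
  \<comment> \<open>Scaling each summand by the multiplier of the other gives both the common
    multiplier \<open>k * l\<close>.\<close>
  moreover from this have "of_nat l *s (of_nat k *s x) + of_nat k *s (of_nat l *s y) \<in> S"
    by (simp only: S_add add_submonoid_of_nat_scale[OF add_submonoid_S])
  then have "of_nat (k * l) *s (x + y) \<in> S"
    by (simp add: vector_add_ldistrib vector_smult_assoc mult.commute)
  ultimately show ?thesis
    unfolding cone_iff by (intro exI[of _ "k * l"]) simp
qed

lemma cone_half:
  assumes "x \<in> rational_cone S"
  shows "(1/2) *s x \<in> rational_cone S"
proof -
  obtain k where "k > 0" "of_nat k *s x \<in> S"
    using assms by (auto simp: cone_iff)
  then show ?thesis
    unfolding cone_iff by (intro exI[of _ "2 * k"]) (simp add: vector_smult_assoc)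
qed

lemma nat_vecs_add: "x \<in> nat_vecs \<Longrightarrow> y \<in> nat_vecs \<Longrightarrow> x + y \<in> nat_vecs"
  using add_submonoid_nat_vecs by (rule add_submonoid_add)

lemma gap_add:
  assumes "g \<in> gaps S" "s \<in> S" "g + s \<notin> S"
  shows "g + s \<in> gaps S"
proof -
  have "s \<in> rational_cone S" "s \<in> nat_vecs"
    using assms(2) S_subset_cone S_subset_nat_vecs by blast+
  with assms show ?thesis
    by (simp add: gaps_def cone_add nat_vecs_add)
qed

section \<open>Greatest elements in the term order and pseudo-Frobenius elements above gaps\<close>

lemma prec_irrefl: "x \<in> nat_vecs \<Longrightarrow> \<not> prec x x"
  using term_order by (auto simp: term_order_def irreflp_on_def)

lemma prec_trans:
  "x \<in> nat_vecs \<Longrightarrow> y \<in> nat_vecs \<Longrightarrow> z \<in> nat_vecs \<Longrightarrow> prec x y \<Longrightarrow> prec y z \<Longrightarrow> prec x z"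
  using term_order unfolding term_order_def transp_on_def by blast

lemma prec_total: "x \<in> nat_vecs \<Longrightarrow> y \<in> nat_vecs \<Longrightarrow> x \<noteq> y \<Longrightarrow> prec x y \<or> prec y x"
  using term_order unfolding term_order_def totalp_on_def by blast

lemma prec_add_pos:
  assumes "x \<in> nat_vecs" "s \<in> nat_vecs" "s \<noteq> 0"
  shows "prec x (x + s)"
proof -
  have "prec 0 s" "0 \<in> nat_vecs"
    using assms term_order by (auto simp: term_order_def nat_vecs_def)
  with assms have "prec (0 + x) (s + x)"
    using term_order unfolding term_order_def by blast
  then show ?thesis by (simp add: add.commute)
qed

lemma finite_has_greatest:
  assumes "finite X" "X \<noteq> {}" "X \<subseteq> nat_vecs"
  shows "\<exists>m\<in>X. \<forall>x\<in>X. x \<noteq> m \<longrightarrow> prec x m"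
  using assms
proof (induction X rule: finite_ne_induct)
  case (insert x X)
  then obtain m where m: "m \<in> X" "\<And>y. y \<in> X \<Longrightarrow> y \<noteq> m \<Longrightarrow> prec y m" by auto
  have nat: "x \<in> nat_vecs" "m \<in> nat_vecs" "\<And>y. y \<in> X \<Longrightarrow> y \<in> nat_vecs"
    using insert.prems m(1) by auto
  from insert.hyps m(1) have "x \<noteq> m" by auto
  then consider "prec x m" | "prec m x"
    using prec_total nat by blast
  then show ?case
  proof cases
    case 1
    then show ?thesis using m by blast
  next
    case 2
    then have "prec y x" if "y \<in> X" for y
      using prec_trans[of y m x] m(2) nat that by metis
    then show ?thesis by blast
  qed
qed auto

lemma gap_below_pseudo_Frobenius:
  assumes "g \<in> gaps S"
  obtains s where "s \<in> S" "g + s \<in> pseudo_Frobenius S"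
proof -
  let ?X = "{h \<in> gaps S. \<exists>s\<in>S. h = g + s}"
  have "g \<in> ?X" using assms zero_in_S by (auto intro!: bexI[of _ 0])
  moreover have "?X \<subseteq> nat_vecs" by (auto simp: gaps_def)
  ultimately obtain m where m: "m \<in> ?X" "\<And>x. x \<in> ?X \<Longrightarrow> x \<noteq> m \<Longrightarrow> prec x m"
    using finite_has_greatest[of ?X] finite_gaps
    by (metis (lifting) empty_iff finite_subset mem_Collect_eq subsetI)
  then obtain s where s: "s \<in> S" "m = g + s" by blast
  \<comment> \<open>Outside \<open>S\<close>, the vector \<open>m + t\<close> would be a gap in
    \<open>?X\<close>, hence below \<open>m\<close> by maximality, although adding a nonzero
    \<open>t\<close> moves up in the term order.\<close>
  have "m + t \<in> S" if t: "t \<in> S" "t \<noteq> 0" for t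
  proof (rule ccontr)
    assume "m + t \<notin> S"
    then have *: "m + t \<in> gaps S" using gap_add m(1) t(1) by blast
    have "m + t = g + (s + t)" by (simp add: s(2) add.assoc)
    with * have "m + t \<in> ?X" using S_add[OF s(1) t(1)] by blast
    then have "prec (m + t) m" using m(2) t(2) by simp
    moreover have nat: "m \<in> nat_vecs" "t \<in> nat_vecs" "m + t \<in> nat_vecs"
      using m(1) * t(1) S_subset_nat_vecs by (auto simp: gaps_def)
    moreover have "prec m (m + t)" using prec_add_pos nat t(2) by blast
    ultimately show False using prec_trans prec_irrefl by blast
  qed
  then have "m \<in> pseudo_Frobenius S"
    using m(1) by (auto simp: pseudo_Frobenius_def)
  with s that show thesis by blast
qed

section \<open>The Frobenius element\<close>

abbreviation F where "F \<equiv> Frobenius prec S"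

text \<open>Finiteness of the gaps gives existence and the strict order gives uniqueness; together
  they make the definite description meaningful.\<close>

lemma is_Frobenius_F: "is_Frobenius prec S F"
proof -
  have nat: "gaps S \<subseteq> nat_vecs" by (auto simp: gaps_def)
  then obtain m where m: "is_Frobenius prec S m"
    using finite_has_greatest[OF finite_gaps gaps_nonempty] by (auto simp: is_Frobenius_def)
  moreover have "m' = m" if m': "is_Frobenius prec S m'" for m'
  proof (rule ccontr)
    assume "m' \<noteq> m"
    then have "prec m m'" "prec m' m" "m \<in> nat_vecs" "m' \<in> nat_vecs"
      using m m' nat by (auto simp: is_Frobenius_def)
    then show False using prec_trans prec_irrefl by metis
  qed
  ultimately show ?thesis
    unfolding Frobenius_def by (rule theI)
qed

lemma F_gap: "F \<in> gaps S"
  using is_Frobenius_F by (simp add: is_Frobenius_def)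

lemma F_notin_S: "F \<notin> S" and F_in_cone: "F \<in> rational_cone S" and F_nat: "F \<in> nat_vecs"
  using F_gap by (auto simp: gaps_def)

text \<open>Some \<open>F + s\<close> with \<open>s\<close> in \<open>S\<close> is pseudo-Frobenius,
  hence a gap; as no gap exceeds \<open>F\<close>, the summand \<open>s\<close> vanishes.\<close>

lemma F_pseudo_Frobenius: "F \<in> pseudo_Frobenius S"
proof -
  obtain s where s: "s \<in> S" "F + s \<in> pseudo_Frobenius S"
    using gap_below_pseudo_Frobenius F_gap by blast
  then have gap: "F + s \<in> gaps S" by (simp add: pseudo_Frobenius_def)
  have "s = 0"
  proof (rule ccontr)
    assume "s \<noteq> 0"
    then have "prec (F + s) F"
      using is_Frobenius_F gap by (simp add: is_Frobenius_def)
    moreover have "prec F (F + s)"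
      using prec_add_pos F_nat s(1) S_subset_nat_vecs \<open>s \<noteq> 0\<close> by blast
    moreover have "F + s \<in> nat_vecs" using gap by (simp add: gaps_def)
    ultimately show False using F_nat prec_trans prec_irrefl by blast
  qed
  with s show ?thesis by simp
qed

section \<open>Half of the Frobenius element, pseudo-symmetry and the symmetry condition\<close>

lemma half_F_nat:
  assumes "even_vec F"
  shows "(1/2) *s F \<in> nat_vecs"
  unfolding nat_vecs_def
proof (intro CollectI allI)
  fix i
  obtain k :: int where k: "F $ i = 2 * of_int k"
    using assms by (auto simp: even_vec_def)
  \<comment> \<open>Evenness only provides an integer \<open>k\<close>; nonnegativity of the
    coordinate makes it natural.\<close>
  have "F $ i \<in> \<nat>" using F_nat by (simp add: nat_vecs_def)
  then have "0 \<le> F $ i" by (auto elim: Nats_cases)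
  then have "0 \<le> k" using k by simp
  then show "((1/2) *s F) $ i \<in> \<nat>"
    by (auto simp: k elim!: nonneg_int_cases)
qed

lemma double_half: "(1/2) *s (x :: rat^'d) + (1/2) *s x = x"
  by (simp flip: vector_sadd_rdistrib)

lemma half_eqI: "x + x = y \<Longrightarrow> x = (1/2) *s (y :: rat^'d)"
  by (auto simp: vec_eq_iff field_simps)

text \<open>Since \<open>F\<close> is pseudo-Frobenius, cardinality 2 leaves exactly one other
  element \<open>f\<close>. The reflection \<open>g \<mapsto> F - g\<close> must fix it, so
  \<open>f + f = F\<close>, which also gives evenness.\<close>

lemma pseudo_symmetric_iff:
  "pseudo_symmetric prec S \<longleftrightarrow> even_vec F \<and> pseudo_Frobenius S = {F, (1/2) *s F}"
proof
  assume "pseudo_symmetric prec S"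
  then have AS: "almost_symmetric prec S" and card: "card (pseudo_Frobenius S) = 2"
    by (auto simp: pseudo_symmetric_def)
  obtain f where f: "pseudo_Frobenius S = {F, f}" "f \<noteq> F"
    using card F_pseudo_Frobenius unfolding card_2_iff by (metis insertE insert_commute singletonD)
  then have "pseudo_Frobenius' prec S = {f}"
    by (auto simp: pseudo_Frobenius'_def)
  then have "F - f = f" using AS by (simp add: almost_symmetric_def)
  then have F: "f + f = F" by (metis diff_add_cancel)
  have "f \<in> nat_vecs" using f by (auto simp: pseudo_Frobenius_def gaps_def)
  then have "even_vec F"
    unfolding even_vec_def nat_vecs_def F[symmetric]
    by (metis (lifting) Nats_cases mem_Collect_eq mult_2 of_int_of_nat_eq vector_add_component)
  with f(1) half_eqI[OF F] show "even_vec F \<and> pseudo_Frobenius S = {F, (1/2) *s F}" by simp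
next
  assume R: "even_vec F \<and> pseudo_Frobenius S = {F, (1/2) *s F}"
  \<comment> \<open>A nonzero \<open>F\<close> differs from its half; this yields both the
    cardinality 2 and the nonemptiness of \<open>pseudo_Frobenius'\<close>.\<close>
  have "F \<noteq> 0" using F_notin_S zero_in_S by metis
  then have ne: "(1/2) *s F \<noteq> F" by (auto simp: vec_eq_iff)
  then have PF': "pseudo_Frobenius' prec S = {(1/2) *s F}"
    using R by (auto simp: pseudo_Frobenius'_def)
  have "F - (1/2) *s F = (1/2) *s F"
    using double_half[of F] by (metis add_diff_cancel)
  then have "almost_symmetric prec S"
    using is_Frobenius_F by (auto simp: almost_symmetric_def PF')
  moreover have "card (pseudo_Frobenius S) = 2" using R ne by simp
  ultimately show "pseudo_symmetric prec S" by (simp add: pseudo_symmetric_def)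
qed

text \<open>If \<open>g\<close> and \<open>F - g\<close> were both in \<open>S\<close>, so would be
  their sum \<open>F\<close>. A gap \<open>g\<close> lifts to \<open>F\<close> or to
  \<open>F/2\<close> by some \<open>s\<close> in \<open>S\<close>, and either lift contradicts the
  right-hand side.\<close>

lemma symmetry_of_pseudo_Frobenius:
  assumes PF: "pseudo_Frobenius S = {F, (1/2) *s F}"
    and g: "g \<in> rational_cone S \<inter> nat_vecs"
  shows "g \<in> S \<longleftrightarrow> F - g \<notin> S \<and> g \<noteq> (1/2) *s F"
proof
  have "(1/2) *s F \<notin> S" using PF by (auto simp: pseudo_Frobenius_def gaps_def)
  moreover assume "g \<in> S"
  ultimately show "F - g \<notin> S \<and> g \<noteq> (1/2) *s F"
    using S_add[of "F - g" g] F_notin_S by auto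
next
  assume R: "F - g \<notin> S \<and> g \<noteq> (1/2) *s F"
  show "g \<in> S"
  proof (rule ccontr)
    assume "g \<notin> S"
    then obtain s where s: "s \<in> S" "g + s \<in> pseudo_Frobenius S"
      using gap_below_pseudo_Frobenius g by (auto simp: gaps_def)
    then consider "g + s = F" | "g + s = (1/2) *s F" using PF by blast
    then show False
    proof cases
      case 1
      then have "F - g = s" by (metis add_diff_cancel_left')
      with R s show False by simp
    next
      case 2
      \<comment> \<open>Here \<open>g \<noteq> F/2\<close> enters: it allows the pseudo-Frobenius
        property of \<open>F/2\<close> to be applied to \<open>s\<close>, placing
        \<open>F - g = F/2 + s\<close> in \<open>S\<close>.\<close>
      with R have "s \<noteq> 0" by auto
      then have "(1/2) *s F + s \<in> S"
        using PF s(1) by (auto simp: pseudo_Frobenius_def)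
      moreover have "F - g = (1/2) *s F + ((1/2) *s F - g)"
        using double_half[of F] by (metis add_diff_eq)
      moreover have "s = (1/2) *s F - g"
        using 2 by (metis add_diff_cancel_left')
      ultimately show False using R by metis
    qed
  qed
qed

text \<open>Evenness makes \<open>F/2\<close> a natural vector, so the symmetry condition may be
  evaluated at \<open>F/2\<close> and at its translates by \<open>S\<close>.\<close>

lemma pseudo_Frobenius_of_symmetry:
  assumes "even_vec F"
    and sym: "\<And>g. g \<in> rational_cone S \<inter> nat_vecs \<Longrightarrow>
      g \<in> S \<longleftrightarrow> F - g \<notin> S \<and> g \<noteq> (1/2) *s F"
  shows "pseudo_Frobenius S = {F, (1/2) *s F}"
proof (intro equalityI subsetI)
  fix f assume f: "f \<in> pseudo_Frobenius S"
  then have fg: "f \<in> rational_cone S \<inter> nat_vecs" "f \<notin> S"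
    by (auto simp: pseudo_Frobenius_def gaps_def)
  then consider "F - f \<in> S" | "f = (1/2) *s F" using sym by blast
  then show "f \<in> {F, (1/2) *s F}"
  proof cases
    case 1
    have "F - f = 0"
    proof (rule ccontr)
      assume "F - f \<noteq> 0"
      \<comment> \<open>A nonzero \<open>F - f\<close> in \<open>S\<close> would be a legitimate
        summand for the pseudo-Frobenius element \<open>f\<close>, and the sum is
        \<open>F\<close>.\<close>
      with 1 f have "f + (F - f) \<in> S" unfolding pseudo_Frobenius_def by blast
      with F_notin_S show False by simp
    qed
    then show ?thesis by simp
  qed simp
next
  fix f assume "f \<in> {F, (1/2) *s F}"
  let ?h = "(1/2) *s F"
  have h: "?h \<in> rational_cone S \<inter> nat_vecs"
    using cone_half F_in_cone half_F_nat assms(1) by blast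
  \<comment> \<open>At \<open>g = F/2\<close> the right-hand side fails through its second
    conjunct.\<close>
  then have hS: "?h \<notin> S" using sym by blast
  have "?h + s \<in> S" if s: "s \<in> S" "s \<noteq> 0" for s
  proof -
    \<comment> \<open>The difference equals \<open>?h - s\<close>; if it were in \<open>S\<close>,
      adding \<open>s\<close> would put \<open>?h\<close> there too.\<close>
    have "F - (?h + s) \<notin> S"
    proof
      assume "F - (?h + s) \<in> S"
      then have "F - (?h + s) + s \<in> S" using S_add s(1) by blast
      moreover have "F - (?h + s) + s = ?h" by (simp add: vec_eq_iff)
      ultimately show False using hS by simp
    qed
    moreover have "?h + s \<in> rational_cone S \<inter> nat_vecs"
      using h s(1) cone_add nat_vecs_add S_subset_cone S_subset_nat_vecs by blast
    ultimately show ?thesis using sym[of "?h + s"] s(2) by simp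
  qed
  then have "?h \<in> pseudo_Frobenius S"
    using h hS by (auto simp: pseudo_Frobenius_def gaps_def)
  with \<open>f \<in> {F, ?h}\<close> F_pseudo_Frobenius show "f \<in> pseudo_Frobenius S" by blast
qed

end

theorem theorem3p7:
  fixes S :: "(rat^'d::finite) set"
    and prec :: "rat^'d \<Rightarrow> rat^'d \<Rightarrow> bool"
  assumes "C_semigroup S"
    and "term_order prec"
  shows "pseudo_symmetric prec S \<longleftrightarrow>
    even_vec (Frobenius prec S) \<and>
    (\<forall>g \<in> rational_cone S \<inter> nat_vecs.
       g \<in> S \<longleftrightarrow> (Frobenius prec S - g \<notin> S \<and> g \<noteq> (1/2) *s Frobenius prec S))"
proof -
  interpret C_semigroup_order S prec
    using assms by unfold_locales
  show ?thesis
    unfolding pseudo_symmetric_iff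
    using symmetry_of_pseudo_Frobenius pseudo_Frobenius_of_symmetry by blast
qed

end
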